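(* For $|q|<1$, $$\mathrm{C}\Phi_8(q)=\frac{1}{(q;q)_\infty^8}\Big(\Theta_3^7(q^4)+28\Theta_3^6(q^4)\Theta_2(q^4)+105\Theta_3^5(q^4)\Theta_2^2(q^4)+112\Theta_3^4(q^4)\Theta_2^3(q^4)$$ $$+147\Theta_3^3(q^4)\Theta_2^4(q^4)+84\Theta_3^2(q^4)\Theta_2^5(q^4)+35\Theta_3(q^4)\Theta_2^6(q^4)\Big).$$
   Context: A $k$-colored generalized Frobenius symbol is a two-row array with $d\ge 0$ columns whose entries are colored nonnegative integers $\ell_c$ ($\ell\ge 0$, color $c\in\{1,\dots,k\}$), each row strictly decreasing with respect to the total order $0_1\prec 0_2\prec\cdots\prec 0_k\prec 1_1\prec\cdots\prec 1_k\prec 2_1\prec\cdots$. It is a $k$-colored generalized Frobenius partition of $n=d+\sum(\text{integer values of all entries})$. $c\phi_k(n)$ is the number of such partitions of $n$ (with $c\phi_k(0)=1$), and $\mathrm{C}\Phi_k(q)=\sum_{n\ge0}c\phi_k(n)q^n$. $(a;q)_\infty=\prod_{j\ge1}(1-aq^{j-1})$, $\Theta_3(x)=\sum_{j\in\mathbf Z}x^{j^2}$ and $\Theta_2(x)=\sum_{j\in\mathbf Z}x^{(j+1/2)^2}$. *)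

theory Defs
  imports "HOL-Analysis.Analysis"
begin

text \<open>The pair \<open>(l, c)\<close> encodes the coloured integer \<open>l\<^sub>c\<close>.\<close>

definition colored_less :: "nat \<times> nat \<Rightarrow> nat \<times> nat \<Rightarrow> bool" where
  "colored_less x y \<longleftrightarrow> fst x < fst y \<or> (fst x = fst y \<and> snd x < snd y)"

definition frobenius_row :: "nat \<Rightarrow> (nat \<times> nat) list \<Rightarrow> bool" where
  "frobenius_row k xs \<longleftrightarrow>
     (\<forall>x \<in> set xs. snd x \<in> {1..k}) \<and> sorted_wrt (\<lambda>x y. colored_less y x) xs"

definition frobenius_symbols :: "nat \<Rightarrow> ((nat \<times> nat) list \<times> (nat \<times> nat) list) set" where
  "frobenius_symbols k =
     {(xs, ys). length xs = length ys \<and> frobenius_row k xs \<and> frobenius_row k ys}"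

definition frobenius_size :: "(nat \<times> nat) list \<times> (nat \<times> nat) list \<Rightarrow> nat" where
  "frobenius_size s = length (fst s) + sum_list (map fst (fst s)) + sum_list (map fst (snd s))"

definition frobenius_partitions :: "nat \<Rightarrow> nat \<Rightarrow> ((nat \<times> nat) list \<times> (nat \<times> nat) list) set" where
  "frobenius_partitions k n = {s \<in> frobenius_symbols k. frobenius_size s = n}"

definition cphi :: "nat \<Rightarrow> nat \<Rightarrow> nat" where
  "cphi k n = card (frobenius_partitions k n)"

lemma finite_frobenius_partitions: "finite (frobenius_partitions k n)"
proof -
  let ?L = "{xs. set xs \<subseteq> {..n} \<times> {1..k} \<and> length xs \<le> n}"
  have "s \<in> ?L \<times> ?L" if "s \<in> frobenius_partitions k n" for s
  proof -
    obtain xs ys where s: "s = (xs, ys)" by fastforce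
    have n: "n = length xs + sum_list (map fst xs) + sum_list (map fst ys)"
      and l: "length xs = length ys"
      and c: "\<forall>x \<in> set xs. snd x \<in> {1..k}" "\<forall>x \<in> set ys. snd x \<in> {1..k}"
      using that unfolding s frobenius_partitions_def frobenius_symbols_def
        frobenius_size_def frobenius_row_def by auto
    have "fst x \<le> sum_list (map fst zs)" if "x \<in> set zs" for x :: "nat \<times> nat" and zs
      using that by (intro member_le_sum_list) auto
    hence "\<forall>x \<in> set xs. fst x \<le> n" "\<forall>x \<in> set ys. fst x \<le> n"
      using n by (meson le_add1 le_add2 le_trans)+
    thus ?thesis using c l n unfolding s by (auto simp: mem_Times_iff)
  qed
  moreover have "finite (?L \<times> ?L)"
    by (intro finite_cartesian_product finite_lists_length_le) auto
  ultimately show ?thesis by (meson finite_subset subsetI)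
qed

lemma cphi_0: "cphi k 0 = 1"
proof -
  have "frobenius_partitions k 0 = {([], [])}"
    by (auto simp: frobenius_partitions_def frobenius_symbols_def frobenius_size_def
        frobenius_row_def)
  thus ?thesis by (simp add: cphi_def)
qed

definition CPhi :: "nat \<Rightarrow> complex \<Rightarrow> complex" where
  "CPhi k q = (\<Sum>n. of_nat (cphi k n) * q ^ n)"

definition qpoch_inf :: "complex \<Rightarrow> complex \<Rightarrow> complex" where
  "qpoch_inf a q = prodinf (\<lambda>j. 1 - a * q ^ j)"

definition Theta3 :: "complex \<Rightarrow> complex" where
  "Theta3 x = (\<Sum>\<^sub>\<infinity>j::int. x ^ nat (j\<^sup>2))"

text \<open>
  The exponents \<open>(j + 1/2)\<^sup>2 = (2 j + 1)\<^sup>2 / 4\<close> of \<open>\<Theta>\<^sub>2(x)\<close> are not integers, so for complex \<open>x\<close> the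
  series depends on the choice of a fourth root of \<open>x\<close>.  The argument \<open>r\<close> below is that root:
  \<open>Theta2_root r\<close> is \<open>\<Theta>\<^sub>2(x)\<close> for \<open>x = r\<^sup>4\<close> and \<open>x\<^bsup>1/4\<^esup> = r\<close>.  In particular \<open>\<Theta>\<^sub>2(q\<^sup>4)\<close>, a power
  series in \<open>q\<close>, is \<open>Theta2_root q\<close>; the principal branch of \<open>(q\<^sup>4)\<^bsup>1/4\<^esup>\<close> would be wrong for
  general complex \<open>q\<close>.
\<close>

definition Theta2_root :: "complex \<Rightarrow> complex" where
  "Theta2_root r = (\<Sum>\<^sub>\<infinity>j::int. r ^ nat ((2 * j + 1)\<^sup>2))"

lemma Theta2_root_exp:
  "Theta2_root (exp (w / 4)) = (\<Sum>\<^sub>\<infinity>j::int. exp (w * (of_int j + 1 / 2)\<^sup>2))"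
  unfolding Theta2_root_def
proof (rule infsum_cong)
  fix j :: int
  have "exp (w / 4) ^ nat ((2 * j + 1)\<^sup>2) = exp (of_nat (nat ((2 * j + 1)\<^sup>2)) * (w / 4))"
    by (simp only: exp_of_nat_mult)
  also have "(of_nat (nat ((2 * j + 1)\<^sup>2)) :: complex) = (2 * of_int j + 1)\<^sup>2"
    by (simp add: of_nat_nat)
  also have "(2 * of_int j + 1)\<^sup>2 * (w / 4) = w * (of_int j + 1 / 2)\<^sup>2"
    by (simp add: power2_eq_square field_simps)
  finally show "exp (w / 4) ^ nat ((2 * j + 1)\<^sup>2) = exp (w * (of_int j + 1 / 2)\<^sup>2)" .
qed

lemma Theta2_root_real:
  assumes "0 \<le> (q::real)"
  shows "Theta2_root (of_real q) =
    (\<Sum>\<^sub>\<infinity>j::int. of_real ((q ^ 4) powr ((real_of_int j + 1 / 2)\<^sup>2)))"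
  unfolding Theta2_root_def
proof (rule infsum_cong)
  fix j :: int
  have odd: "2 * j + 1 \<noteq> 0" by presburger
  have "(q ^ 4) powr ((real_of_int j + 1 / 2)\<^sup>2) = q ^ nat ((2 * j + 1)\<^sup>2)"
  proof (cases "q = 0")
    case True
    thus ?thesis using odd by (simp add: power_0_left)
  next
    case False
    hence "q > 0" using assms by simp
    have "(q ^ 4) powr ((real_of_int j + 1 / 2)\<^sup>2) = q powr (4 * (real_of_int j + 1 / 2)\<^sup>2)"
      using \<open>q > 0\<close> powr_powr[of q 4 "(real_of_int j + 1 / 2)\<^sup>2"] by simp
    also have "4 * (real_of_int j + 1 / 2)\<^sup>2 = (2 * real_of_int j + 1)\<^sup>2"
      by (simp add: power2_eq_square field_simps)
    also have "\<dots> = real (nat ((2 * j + 1)\<^sup>2))"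
      by (simp add: of_nat_nat)
    finally show ?thesis using \<open>q > 0\<close> by (simp only: powr_realpow)
  qed
  thus "(of_real q :: complex) ^ nat ((2 * j + 1)\<^sup>2) =
      of_real ((q ^ 4) powr ((real_of_int j + 1 / 2)\<^sup>2))" by simp
qed

end

theory Submission
  imports Defs
begin

text \<open>
  The two rows of a symbol form a finite set of coloured entries, in which entries of the top row
  have charge \<open>1\<close>, those of the bottom row charge \<open>-1\<close>, and the total charge is \<open>0\<close>.  For one colour
  the sets of charge \<open>m\<close> have generating function \<open>s\<^bsup>m\<^sup>2\<^esup> / (q;q)\<^sub>\<infinity>\<close> with \<open>s\<^sup>2 = q\<close>; this is the
  Jacobi triple product, a limit of \<open>q\<close>-binomial coefficients.  Colours are independent, so \<open>k\<close>
  colours give the \<open>k\<close>-fold convolution power of the Gaussian \<open>m \<mapsto> s\<^bsup>m\<^sup>2\<^esup>\<close> over \<open>(q;q)\<^sub>\<infinity>\<^sup>k\<close>,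
  evaluated at charge \<open>0\<close>.  By the parallelogram law \<open>b\<^sup>2 + (a - b)\<^sup>2 = (a\<^sup>2 + (2 b - a)\<^sup>2) / 2\<close>,
  convolving such a function with itself again produces Gaussians, times theta series over one
  parity class.  Three doublings express the case \<open>k = 8\<close> by theta series at \<open>r\<close>, \<open>r\<^sup>2\<close> and
  \<open>r\<^sup>4 = q\<close>, and the classical duplication formulas reduce all of them to \<open>r\<^sup>4\<close>.
\<close>

section \<open>Generating functions of finite subsets by charge\<close>

lemma has_sum_Times:
  fixes f :: "'a \<Rightarrow> complex" and g :: "'b \<Rightarrow> complex"
  assumes f: "(f has_sum a) A" and g: "(g has_sum b) B"
  shows "((\<lambda>(x, y). f x * g y) has_sum (a * b)) (A \<times> B)"
proof -
  have f_abs: "(\<lambda>x. norm (f x)) summable_on A" and g_abs: "(\<lambda>y. norm (g y)) summable_on B"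
    using f g
    by (auto simp: has_sum_imp_summable simp flip: summable_on_iff_abs_summable_on_complex)
  have "(\<lambda>z. norm (case z of (x, y) \<Rightarrow> f x * g y)) summable_on (A \<times> B)"
  proof (subst Infinite_Sum.abs_summable_on_Sigma_iff, intro conjI ballI)
    fix x
    show "(\<lambda>y. norm (case (x, y) of (x, y) \<Rightarrow> f x * g y)) summable_on B"
      using summable_on_cmult_right[OF g_abs, of "norm (f x)"] by (simp add: norm_mult)
  next
    have "(\<lambda>x. norm (f x) * (\<Sum>\<^sub>\<infinity>y\<in>B. norm (g y))) summable_on A"
      by (rule summable_on_cmult_left[OF f_abs])
    thus "(\<lambda>x. norm (\<Sum>\<^sub>\<infinity>y\<in>B. norm (case (x, y) of (x, y) \<Rightarrow> f x * g y))) summable_on A"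
      by (simp add: norm_mult infsum_cmult_right' abs_mult infsum_nonneg)
  qed
  hence "(\<lambda>(x, y). f x * g y) summable_on (A \<times> B)"
    by (rule abs_summable_summable)
  thus ?thesis
    using has_sum_cmult_right[OF g] has_sum_cmult_left[OF f, of b]
    by (intro has_sum_SigmaI) simp_all
qed

lemma norm_prod_summable_on_Fpow:
  fixes f :: "'a \<Rightarrow> 'b::real_normed_field"
  assumes f: "(\<lambda>x. norm (f x)) summable_on E"
  shows "(\<lambda>X. norm (prod f X)) summable_on Fpow E"
proof (rule nonneg_bdd_above_summable_on)
  show "bdd_above (sum (\<lambda>X. norm (prod f X)) ` {F. F \<subseteq> Fpow E \<and> finite F})"
  proof (rule bdd_aboveI2)
    fix F assume "F \<in> {F. F \<subseteq> Fpow E \<and> finite F}"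
    hence fin: "finite F" "finite (\<Union>F)" and sub: "\<Union>F \<subseteq> E" by (auto simp: Fpow_def)
    have "(\<Sum>X\<in>F. norm (prod f X)) \<le> (\<Sum>X\<in>Pow (\<Union>F). norm (prod f X))"
      using fin by (intro sum_mono2) auto
    also have "\<dots> = (\<Prod>x\<in>\<Union>F. norm (f x) + 1)"
      by (simp add: prod_add[OF fin(2)] prod_norm)
    also have "\<dots> \<le> exp (\<Sum>x\<in>\<Union>F. norm (f x))"
      unfolding add.commute[of _ 1] by (rule prod_le_exp_sum) simp
    also have "\<dots> \<le> exp (\<Sum>\<^sub>\<infinity>x\<in>E. norm (f x))"
      using finite_sum_le_infsum[OF f fin(2) sub] by simp
    finally show "(\<Sum>X\<in>F. norm (prod f X)) \<le> exp (\<Sum>\<^sub>\<infinity>x\<in>E. norm (f x))" .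
  qed
qed simp

definition charged_subsets :: "('a \<Rightarrow> int) \<Rightarrow> 'a set \<Rightarrow> int \<Rightarrow> 'a set set" where
  "charged_subsets \<sigma> E m = {X \<in> Fpow E. sum \<sigma> X = m}"

definition charge_gf :: "('a \<Rightarrow> int) \<Rightarrow> ('a \<Rightarrow> complex) \<Rightarrow> 'a set \<Rightarrow> int \<Rightarrow> complex" where
  "charge_gf \<sigma> f E m = (\<Sum>\<^sub>\<infinity>X\<in>charged_subsets \<sigma> E m. prod f X)"

lemma has_sum_charge_gf:
  assumes "(\<lambda>x. norm (f x)) summable_on E"
  shows "(prod f has_sum charge_gf \<sigma> f E m) (charged_subsets \<sigma> E m)"
proof -
  have "prod f summable_on Fpow E"
    using norm_prod_summable_on_Fpow[OF assms] by (rule abs_summable_summable)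
  hence "prod f summable_on charged_subsets \<sigma> E m"
    by (rule summable_on_subset_banach) (auto simp: charged_subsets_def)
  thus ?thesis unfolding charge_gf_def by (rule has_sum_infsum)
qed

lemma charged_subsets_empty: "charged_subsets \<sigma> {} m = (if m = 0 then {{}} else {})"
  by (auto simp: charged_subsets_def Fpow_def)

lemma charge_gf_empty: "charge_gf \<sigma> f {} m = (if m = 0 then 1 else 0)"
  by (simp add: charge_gf_def charged_subsets_empty)

lemma charge_gf_finite:
  "finite E \<Longrightarrow> charge_gf \<sigma> f E m = sum (prod f) (charged_subsets \<sigma> E m)"
  by (simp add: charge_gf_def charged_subsets_def Fpow_Pow_finite)

lemma charge_gf_insert:
  assumes f: "(\<lambda>x. norm (f x)) summable_on E" and x: "x \<notin> E"
  shows "charge_gf \<sigma> f (insert x E) m = charge_gf \<sigma> f E m + f x * charge_gf \<sigma> f E (m - \<sigma> x)"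
proof -
  let ?A = "charged_subsets \<sigma> E m" and ?B = "charged_subsets \<sigma> E (m - \<sigma> x)"
  have mem: "finite X \<and> X \<subseteq> E \<and> x \<notin> X" if "X \<in> ?B" for X
    using that x by (auto simp: charged_subsets_def Fpow_def)
  have "charged_subsets \<sigma> (insert x E) m = ?A \<union> insert x ` ?B"
  proof (intro equalityI subsetI)
    fix X assume X: "X \<in> charged_subsets \<sigma> (insert x E) m"
    show "X \<in> ?A \<union> insert x ` ?B"
    proof (cases "x \<in> X")
      case True
      have "X - {x} \<in> ?B" "X = insert x (X - {x})"
        using X True by (auto simp: charged_subsets_def Fpow_def sum_diff1)
      thus ?thesis by blast
    qed (use X in \<open>auto simp: charged_subsets_def Fpow_def\<close>)
  qed (use x in \<open>auto simp: charged_subsets_def Fpow_def sum.insert_if\<close>)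
  moreover have "(prod f has_sum f x * charge_gf \<sigma> f E (m - \<sigma> x)) (insert x ` ?B)"
  proof (subst has_sum_reindex)
    show "inj_on (insert x) ?B" using mem by (intro inj_onI) (metis insert_ident)
    have "((\<lambda>X. f x * prod f X) has_sum f x * charge_gf \<sigma> f E (m - \<sigma> x)) ?B"
      by (intro has_sum_cmult_right has_sum_charge_gf f)
    thus "(prod f \<circ> insert x has_sum f x * charge_gf \<sigma> f E (m - \<sigma> x)) ?B"
      by (rule has_sum_cong[THEN iffD1, rotated]) (simp add: mem)
  qed
  moreover have "?A \<inter> insert x ` ?B = {}" using x by (auto simp: charged_subsets_def Fpow_def)
  ultimately show ?thesis
    unfolding charge_gf_def[of \<sigma> f "insert x E"]
    by (intro infsumI) (auto intro: has_sum_Un_disjoint has_sum_charge_gf f)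
qed

lemma bij_betw_Un_charged_subsets:
  assumes disj: "E \<inter> F = {}"
  shows "bij_betw (\<lambda>(j, X, Y). X \<union> Y)
    (SIGMA j:UNIV. charged_subsets \<sigma> E j \<times> charged_subsets \<sigma> F (m - j))
    (charged_subsets \<sigma> (E \<union> F) m)" (is "bij_betw ?f ?A ?B")
proof (rule bij_betwI)
  let ?g = "\<lambda>X. (sum \<sigma> (X \<inter> E), X \<inter> E, X \<inter> F)"
  have sum_Un: "sum \<sigma> (X \<union> Y) = sum \<sigma> X + sum \<sigma> Y" if "X \<in> Fpow E" "Y \<in> Fpow F" for X Y
    using that disj by (intro sum.union_disjoint) (auto simp: Fpow_def)
  have parts: "X \<inter> E \<in> Fpow E" "X \<inter> F \<in> Fpow F" "X = (X \<inter> E) \<union> (X \<inter> F)"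
    if "X \<in> Fpow (E \<union> F)" for X
    using that by (auto simp: Fpow_def)
  have Un_parts: "(X \<union> Y) \<inter> E = X" "(X \<union> Y) \<inter> F = Y" "X \<union> Y \<in> Fpow (E \<union> F)"
    if "X \<in> Fpow E" "Y \<in> Fpow F" for X Y
    using that disj by (auto simp: Fpow_def)
  show "?f \<in> ?A \<rightarrow> ?B" by (auto simp: charged_subsets_def sum_Un Un_parts)
  show "?g \<in> ?B \<rightarrow> ?A"
  proof
    fix X assume X: "X \<in> ?B"
    hence fpow: "X \<in> Fpow (E \<union> F)" by (simp add: charged_subsets_def)
    have "sum \<sigma> (X \<inter> E) + sum \<sigma> (X \<inter> F) = m"
      using X sum_Un[OF parts(1,2)[OF fpow]] parts(3)[OF fpow] by (simp add: charged_subsets_def)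
    thus "?g X \<in> ?A" using parts(1,2)[OF fpow] by (simp add: charged_subsets_def)
  qed
  show "?g (?f z) = z" if z: "z \<in> ?A" for z
  proof -
    obtain X Y where "z = (sum \<sigma> X, X, Y)" "X \<in> Fpow E" "Y \<in> Fpow F"
      using z by (auto simp: charged_subsets_def)
    thus ?thesis by (simp add: Un_parts)
  qed
  show "?f (?g X) = X" if "X \<in> ?B" for X
    using that parts(3)[of X] by (simp add: charged_subsets_def)
qed

lemma charge_gf_Un:
  assumes E: "(\<lambda>x. norm (f x)) summable_on E" and F: "(\<lambda>x. norm (f x)) summable_on F"
    and disj: "E \<inter> F = {}"
  shows "((\<lambda>j. charge_gf \<sigma> f E j * charge_gf \<sigma> f F (m - j)) has_sum
    charge_gf \<sigma> f (E \<union> F) m) UNIV"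
proof -
  let ?T = "SIGMA j:UNIV. charged_subsets \<sigma> E j \<times> charged_subsets \<sigma> F (m - j)"
  have prod_Un: "prod f (X \<union> Y) = prod f X * prod f Y"
    if "X \<in> charged_subsets \<sigma> E i" "Y \<in> charged_subsets \<sigma> F j" for X Y i j
    using that disj by (intro prod.union_disjoint) (auto simp: charged_subsets_def Fpow_def)
  have "(prod f has_sum charge_gf \<sigma> f (E \<union> F) m) (charged_subsets \<sigma> (E \<union> F) m)"
    by (intro has_sum_charge_gf summable_on_union E F)
  also have "?this \<longleftrightarrow>
      ((\<lambda>z. prod f (case z of (j, X, Y) \<Rightarrow> X \<union> Y)) has_sum charge_gf \<sigma> f (E \<union> F) m) ?T"
    by (rule has_sum_reindex_bij_betw[OF bij_betw_Un_charged_subsets[OF disj], symmetric])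
  also have "\<dots> \<longleftrightarrow>
      ((\<lambda>(j, X, Y). prod f X * prod f Y) has_sum charge_gf \<sigma> f (E \<union> F) m) ?T"
    by (rule has_sum_cong) (auto simp: prod_Un)
  finally show ?thesis
  proof (rule has_sum_SigmaD)
    fix j
    show "((\<lambda>z. case (j, z) of (j, X, Y) \<Rightarrow> prod f X * prod f Y) has_sum
        charge_gf \<sigma> f E j * charge_gf \<sigma> f F (m - j))
        (charged_subsets \<sigma> E j \<times> charged_subsets \<sigma> F (m - j))"
      using has_sum_Times[OF has_sum_charge_gf[OF E] has_sum_charge_gf[OF F]] by simp
  qed
qed

lemma charge_gf_tendsto:
  assumes f: "(\<lambda>x. norm (f x)) summable_on (\<Union>n. E n)"
    and fin: "\<And>n. finite (E n)" and inc: "incseq E"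
  shows "(\<lambda>n. charge_gf \<sigma> f (E n) m) \<longlonglongrightarrow> charge_gf \<sigma> f (\<Union>n. E n) m"
proof -
  let ?S = "\<lambda>n. charged_subsets \<sigma> (E n) m"
  have "filterlim ?S (finite_subsets_at_top (charged_subsets \<sigma> (\<Union>n. E n) m)) sequentially"
    unfolding filterlim_finite_subsets_at_top
  proof (intro allI impI, elim conjE)
    fix F assume "finite F" and F: "F \<subseteq> charged_subsets \<sigma> (\<Union>n. E n) m"
    hence fin_F: "finite (\<Union>F)" by (auto simp: charged_subsets_def Fpow_def)
    have sub_F: "\<Union>F \<subseteq> (\<Union>n. E n)"
      using F unfolding charged_subsets_def Fpow_def by blast
    have "\<forall>\<^sub>F n in sequentially. x \<in> E n" if x: "x \<in> \<Union>F" for x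
    proof -
      obtain N where "x \<in> E N" using x sub_F by blast
      thus ?thesis using incseqD[OF inc] by (intro eventually_sequentiallyI[of N]) blast
    qed
    hence "\<forall>\<^sub>F n in sequentially. \<forall>x\<in>\<Union>F. x \<in> E n"
      using fin_F by (intro eventually_ball_finite) auto
    thus "\<forall>\<^sub>F n in sequentially. finite (?S n) \<and> F \<subseteq> ?S n \<and> ?S n \<subseteq> charged_subsets \<sigma> (\<Union>n. E n) m"
    proof eventually_elim
      case (elim n)
      hence "F \<subseteq> ?S n" using F unfolding charged_subsets_def Fpow_def by blast
      moreover have "finite (?S n)" using fin by (simp add: charged_subsets_def Fpow_Pow_finite)
      moreover have "?S n \<subseteq> charged_subsets \<sigma> (\<Union>n. E n) m"
        unfolding charged_subsets_def Fpow_def by blast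
      ultimately show ?case by blast
    qed
  qed
  thus ?thesis
    using has_sum_charge_gf[OF f] unfolding charge_gf_finite[OF fin] has_sum_def
    by (rule filterlim_compose[rotated])
qed

section \<open>Gaussians and \<open>q\<close>-binomial coefficients\<close>

definition gaussian :: "'a::monoid_mult \<Rightarrow> int \<Rightarrow> 'a" where
  "gaussian r n = r ^ nat (n\<^sup>2)"

lemma gaussian_minus [simp]: "gaussian r (- n) = gaussian r n"
  by (simp add: gaussian_def)

lemma gaussian_square: "(gaussian r n)\<^sup>2 = gaussian (r\<^sup>2) n"
  by (simp add: gaussian_def mult.commute flip: power_mult)

lemma gaussian_double: "gaussian r (2 * n) = gaussian (r ^ 4) n"
proof -
  have "nat ((2 * n)\<^sup>2) = 4 * nat (n\<^sup>2)"
    by (intro int_int_eq[THEN iffD1]) (simp add: power_mult_distrib)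
  thus ?thesis by (simp only: gaussian_def power_mult)
qed

lemma gaussian_parallelogram:
  "gaussian r (u + v) * gaussian r (u - v) = gaussian (r\<^sup>2) u * gaussian (r\<^sup>2) v"
proof -
  have "nat ((u + v)\<^sup>2) + nat ((u - v)\<^sup>2) = 2 * nat (u\<^sup>2) + 2 * nat (v\<^sup>2)"
    by (intro int_int_eq[THEN iffD1], simp, simp add: power2_eq_square algebra_simps)
  thus ?thesis by (simp only: gaussian_def flip: power_add power_mult)
qed

definition qpoch :: "'a::comm_ring_1 \<Rightarrow> nat \<Rightarrow> 'a" where
  "qpoch q n = (\<Prod>i<n. 1 - q * q ^ i)"

text \<open>Extending \<open>1 / (q;q)\<^sub>n\<close> by \<open>0\<close> to negative \<open>n\<close> preserves its recurrence, so that the Pascal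
  rule for \<open>qbinomial q i j\<close>, the Gaussian binomial coefficient of \<open>i + j\<close> over \<open>i\<close>, has no
  boundary cases besides \<open>i = j = 0\<close>.\<close>

definition inverse_qpoch :: "'a::field \<Rightarrow> int \<Rightarrow> 'a" where
  "inverse_qpoch q n = (if n < 0 then 0 else inverse (qpoch q (nat n)))"

definition qbinomial :: "'a::field \<Rightarrow> int \<Rightarrow> int \<Rightarrow> 'a" where
  "qbinomial q i j = qpoch q (nat (i + j)) * inverse_qpoch q i * inverse_qpoch q j"

lemma qbinomial_commute: "qbinomial q i j = qbinomial q j i"
  by (simp add: qbinomial_def ac_simps)

lemma qbinomial_0_0: "qbinomial q 0 0 = 1"
  by (simp add: qbinomial_def inverse_qpoch_def qpoch_def)

lemma qbinomial_neg: "i < 0 \<or> j < 0 \<Longrightarrow> qbinomial q i j = 0"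
  by (auto simp: qbinomial_def inverse_qpoch_def)

lemma qpoch_Suc: "qpoch q (Suc n) = qpoch q n * (1 - q ^ Suc n)"
  by (simp add: qpoch_def)

lemma qpoch_nonzero:
  fixes q :: "'a::idom"
  assumes "\<forall>n>0. q ^ n \<noteq> 1"
  shows "qpoch q n \<noteq> 0"
  using assms by (auto simp: qpoch_def simp flip: power_Suc)

lemma inverse_qpoch_pred:
  fixes q :: "'a::field"
  assumes q: "\<forall>n>0. q ^ n \<noteq> 1"
  shows "inverse_qpoch q (n - 1) = (1 - q ^ nat n) * inverse_qpoch q n"
proof (cases "n > 0")
  case True
  then obtain k where n: "n = int (Suc k)" using zero_less_imp_eq_int by (metis gr0_conv_Suc)
  have "qpoch q (Suc k) \<noteq> 0" using q by (rule qpoch_nonzero)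
  thus ?thesis unfolding n inverse_qpoch_def by (simp add: nat_add_distrib qpoch_Suc)
qed (auto simp: inverse_qpoch_def)

lemma qbinomial_pascal:
  fixes q :: "'a::field"
  assumes q: "\<forall>n>0. q ^ n \<noteq> 1" and pos: "i + j > 0"
  shows "qbinomial q i j = qbinomial q i (j - 1) + q ^ nat j * qbinomial q (i - 1) j"
proof (cases "i < 0 \<or> j < 0")
  case True
  thus ?thesis by (auto simp: qbinomial_neg)
next
  case False
  have "nat (i + j) = Suc (nat (i + j - 1))" using pos by simp
  hence top: "qpoch q (nat (i + j)) = qpoch q (nat (i + j - 1)) * (1 - q ^ nat (i + j))"
    by (simp only: qpoch_Suc)
  have "q ^ nat (i + j) = q ^ nat i * q ^ nat j"
    using False by (simp add: nat_add_distrib power_add)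
  hence "1 - q ^ nat (i + j) = (1 - q ^ nat j) + q ^ nat j * (1 - q ^ nat i)"
    by (simp add: algebra_simps)
  thus ?thesis
    unfolding qbinomial_def top inverse_qpoch_pred[OF q]
    by (simp add: algebra_simps)
qed

lemma norm_power_less_1:
  fixes q :: "'a::real_normed_div_algebra"
  assumes "norm q < 1" "n > 0"
  shows "norm (q ^ n) < 1"
  using assms by (simp add: norm_power power_less_one_iff)

lemma power_neq_1_if_norm_less_1:
  fixes q :: "'a::real_normed_div_algebra"
  assumes "norm q < 1"
  shows "\<forall>n>0. q ^ n \<noteq> 1"
  using norm_power_less_1[OF assms] by (metis less_irrefl norm_one)

lemma qpoch_tendsto:
  assumes q: "norm q < 1"
  shows "qpoch q \<longlonglongrightarrow> qpoch_inf q q" and "qpoch_inf q q \<noteq> 0"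
proof -
  have "summable (\<lambda>i. norm q * norm q ^ i)"
    using q by (intro summable_mult summable_geometric) simp
  hence conv: "convergent_prod (\<lambda>i. 1 - q * q ^ i)"
    by (intro abs_convergent_prod_imp_convergent_prod summable_imp_abs_convergent_prod)
       (simp add: norm_mult norm_power)
  hence "(\<lambda>n. qpoch q (Suc n)) \<longlonglongrightarrow> qpoch_inf q q"
    unfolding qpoch_def qpoch_inf_def lessThan_Suc_atMost by (rule convergent_prod_LIMSEQ)
  thus "qpoch q \<longlonglongrightarrow> qpoch_inf q q" by (simp only: filterlim_sequentially_Suc)
  have "1 - q * q ^ i \<noteq> 0" for i
    using power_neq_1_if_norm_less_1[OF q] by (auto simp flip: power_Suc)
  thus "qpoch_inf q q \<noteq> 0"
    using conv unfolding qpoch_inf_def by (auto dest: prodinf_nonzero)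
qed

lemma qbinomial_tendsto:
  assumes q: "norm q < 1"
  shows "(\<lambda>n. qbinomial q (int n + m) (int n - m)) \<longlonglongrightarrow> 1 / qpoch_inf q q"
proof -
  note lim = qpoch_tendsto[OF q]
  have "((\<lambda>n. inverse (qpoch q (nat n))) \<longlongrightarrow> inverse (qpoch_inf q q)) at_top"
    by (intro tendsto_inverse filterlim_compose[OF lim(1) filterlim_nat_sequentially] lim(2))
  moreover have "\<forall>\<^sub>F n in at_top. inverse (qpoch q (nat n)) = inverse_qpoch q n"
    using eventually_ge_at_top[of 0] by eventually_elim (simp add: inverse_qpoch_def)
  ultimately have inv: "(inverse_qpoch q \<longlongrightarrow> inverse (qpoch_inf q q)) at_top"
    by (rule Lim_transform_eventually)
  have shift: "filterlim (\<lambda>n. int n + k) at_top sequentially" for k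
    unfolding filterlim_at_top eventually_sequentially
  proof
    fix Z :: int
    show "\<exists>N. \<forall>n\<ge>N. Z \<le> int n + k" by (intro exI[of _ "nat (Z - k)"]) auto
  qed
  have double: "filterlim (\<lambda>n::nat. n + n) at_top sequentially"
    unfolding filterlim_at_top eventually_sequentially by (meson le_add1 le_trans)
  have "(\<lambda>n. qpoch q (n + n) * inverse_qpoch q (int n + m) * inverse_qpoch q (int n + - m)) \<longlonglongrightarrow>
      qpoch_inf q q * inverse (qpoch_inf q q) * inverse (qpoch_inf q q)"
    by (intro tendsto_mult filterlim_compose[OF lim(1) double] filterlim_compose[OF inv shift])
  moreover have "nat (int n + m + (int n - m)) = n + n" for n by simp
  ultimately show ?thesis using lim(2) by (simp add: qbinomial_def field_simps)
qed

lemma gaussian_qbinomial_pascal: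
  fixes s :: "'a::field"
  assumes s: "\<forall>n>0. s ^ n \<noteq> 1" and pos: "i + j > 0" and j: "j = int (Suc a) - k"
  shows "gaussian s k * qbinomial (s\<^sup>2) i j =
    gaussian s k * qbinomial (s\<^sup>2) i (j - 1) +
    s ^ (2 * a + 1) * (gaussian s (k - 1) * qbinomial (s\<^sup>2) (i - 1) j)"
proof (cases "j < 0")
  case True
  thus ?thesis by (simp add: qbinomial_neg)
next
  case False
  have "2 * a + 1 + nat ((k - 1)\<^sup>2) = nat (k\<^sup>2) + 2 * nat j"
    using False j by (intro int_int_eq[THEN iffD1], simp, simp add: power2_eq_square algebra_simps)
  hence shift: "s ^ (2 * a + 1) * gaussian s (k - 1) = gaussian s k * (s\<^sup>2) ^ nat j"
    by (simp only: gaussian_def flip: power_add power_mult)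
  have "\<forall>n>0. (s\<^sup>2) ^ n \<noteq> 1" using s by (simp flip: power_mult)
  from qbinomial_pascal[OF this pos] show ?thesis
    unfolding mult.assoc[symmetric] shift by (simp only: ring_distribs mult.assoc)
qed

section \<open>Coloured entries and the Jacobi triple product\<close>

text \<open>\<open>Inl (l, c)\<close> is an entry \<open>l\<^sub>c\<close> of the top row and \<open>Inr (l, c)\<close> one of the bottom row of a
  symbol.  Weighting both by \<open>s\<^bsup>2 l + 1\<^esup>\<close> with \<open>s\<^sup>2 = q\<close> distributes the \<open>d\<close> in the size of a symbol
  evenly over its rows.\<close>

type_synonym 'c entry = "nat \<times> 'c + nat \<times> 'c"

definition entry_charge :: "'c entry \<Rightarrow> int" where
  "entry_charge = case_sum (\<lambda>_. 1) (\<lambda>_. -1)"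

definition entry_weight :: "complex \<Rightarrow> 'c entry \<Rightarrow> complex" where
  "entry_weight s = case_sum (\<lambda>(l, c). s ^ (2 * l + 1)) (\<lambda>(l, c). s ^ (2 * l + 1))"

definition entries :: "'c set \<Rightarrow> 'c entry set" where
  "entries C = (UNIV \<times> C) <+> (UNIV \<times> C)"

abbreviation entry_gf :: "complex \<Rightarrow> 'c entry set \<Rightarrow> int \<Rightarrow> complex" where
  "entry_gf s \<equiv> charge_gf entry_charge (entry_weight s)"

definition frobenius_gf :: "complex \<Rightarrow> 'c set \<Rightarrow> int \<Rightarrow> complex" where
  "frobenius_gf s C = entry_gf s (entries C)"

lemma summable_on_entry_weight:
  assumes s: "norm s < 1" and C: "finite C"
  shows "(\<lambda>x. norm (entry_weight s x)) summable_on entries C"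
proof -
  let ?w = "\<lambda>(l, c). s ^ (2 * l + 1)"
  have "norm (s\<^sup>2) < 1" using s by (simp add: norm_power_less_1)
  hence "summable (\<lambda>l. norm (s\<^sup>2) ^ l)" by (intro summable_geometric) simp
  hence geometric: "summable (\<lambda>l. norm (s * (s\<^sup>2) ^ l))"
    unfolding norm_mult norm_power by (rule summable_mult)
  hence "((\<lambda>l. s * (s\<^sup>2) ^ l) has_sum (\<Sum>l. s * (s\<^sup>2) ^ l)) UNIV"
    using summable_sums[OF summable_norm_cancel[OF geometric]] by (rule norm_summable_imp_has_sum)
  moreover have "((\<lambda>_. 1::complex) has_sum of_nat (card C)) C"
    using C by (intro has_sum_finiteI) simp_all
  ultimately have "((\<lambda>(l, c). s * (s\<^sup>2) ^ l * 1) has_sum (\<Sum>l. s * (s\<^sup>2) ^ l) * of_nat (card C))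
      (UNIV \<times> C)"
    by (rule has_sum_Times)
  hence "?w summable_on (UNIV \<times> C)"
    by (auto dest: has_sum_imp_summable simp: power_mult)
  hence row: "(\<lambda>x. norm (?w x)) summable_on (UNIV \<times> C)"
    by (simp only: summable_on_iff_abs_summable_on_complex)
  show ?thesis
    unfolding entries_def Plus_def
    using row by (intro summable_on_union)
      (simp_all add: summable_on_reindex o_def entry_weight_def)
qed

lemma frobenius_gf_Un:
  assumes "norm s < 1" "finite C" "finite D" "C \<inter> D = {}"
  shows "((\<lambda>j. frobenius_gf s C j * frobenius_gf s D (m - j)) has_sum
    frobenius_gf s (C \<union> D) m) UNIV"
proof -
  have "entries (C \<union> D) = entries C \<union> entries D" "entries C \<inter> entries D = {}"
    using assms by (auto simp: entries_def)
  thus ?thesis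
    using assms charge_gf_Un[OF summable_on_entry_weight summable_on_entry_weight]
    by (simp add: frobenius_gf_def)
qed

lemma frobenius_gf_empty: "frobenius_gf s {} m = (if m = 0 then 1 else 0)"
  by (simp add: frobenius_gf_def entries_def Plus_def charge_gf_empty)

definition truncated_entries :: "nat \<Rightarrow> nat \<Rightarrow> 'c \<Rightarrow> 'c entry set" where
  "truncated_entries a b c = ({..<a} \<times> {c}) <+> ({..<b} \<times> {c})"

lemma entry_gf_truncated_entries_Suc_top:
  "entry_gf s (truncated_entries (Suc a) b c) m =
    entry_gf s (truncated_entries a b c) m +
    s ^ (2 * a + 1) * entry_gf s (truncated_entries a b c) (m - 1)"
proof -
  have "truncated_entries (Suc a) b c = insert (Inl (a, c)) (truncated_entries a b c)"
    "Inl (a, c) \<notin> truncated_entries a b c" "finite (truncated_entries a b c)"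
    by (auto simp: truncated_entries_def)
  thus ?thesis by (simp add: charge_gf_insert entry_charge_def entry_weight_def)
qed

lemma entry_gf_truncated_entries_Suc_bottom:
  "entry_gf s (truncated_entries a (Suc b) c) m =
    entry_gf s (truncated_entries a b c) m +
    s ^ (2 * b + 1) * entry_gf s (truncated_entries a b c) (m + 1)"
proof -
  have "truncated_entries a (Suc b) c = insert (Inr (b, c)) (truncated_entries a b c)"
    "Inr (b, c) \<notin> truncated_entries a b c" "finite (truncated_entries a b c)"
    by (auto simp: truncated_entries_def)
  thus ?thesis by (simp add: charge_gf_insert entry_charge_def entry_weight_def)
qed

text \<open>The coefficient of \<open>z\<^sup>m\<close> in the finite triple product
  \<open>(\<Prod>l<a. 1 + z s\<^bsup>2 l + 1\<^esup>) (\<Prod>l<b. 1 + z\<^bsup>-1\<^esup> s\<^bsup>2 l + 1\<^esup>)\<close>.\<close>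

lemma entry_gf_truncated_entries:
  assumes s: "\<forall>n>0. s ^ n \<noteq> 1"
  shows "entry_gf s (truncated_entries a b c) m =
    gaussian s m * qbinomial (s\<^sup>2) (int b + m) (int a - m)"
proof (induction a arbitrary: m)
  case 0
  have bottom_row: "entry_gf s (truncated_entries 0 b c) (- k) =
      gaussian s k * qbinomial (s\<^sup>2) k (int b - k)" for k
  proof (induction b arbitrary: k)
    case 0
    have "truncated_entries 0 0 c = {}" by (simp add: truncated_entries_def)
    moreover have "k < 0 \<or> k = 0 \<or> k > 0" by linarith
    ultimately show ?case
      by (auto simp: charge_gf_empty qbinomial_0_0 qbinomial_neg gaussian_def)
  next
    case (Suc b)
    show ?case
      using Suc[of k] Suc[of "k - 1"] gaussian_qbinomial_pascal[OF s, of k "int (Suc b) - k" b k]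
      by (simp add: entry_gf_truncated_entries_Suc_bottom algebra_simps)
  qed
  show ?case using bottom_row[of "- m"] by (simp add: qbinomial_commute)
next
  case (Suc a)
  show ?case
    using gaussian_qbinomial_pascal[OF s, of "int b + m" "int (Suc a) - m" a m]
    by (simp add: entry_gf_truncated_entries_Suc_top Suc algebra_simps)
qed

theorem frobenius_gf_singleton:
  assumes s: "norm s < 1"
  shows "frobenius_gf s {c} m = gaussian s m / qpoch_inf (s\<^sup>2) (s\<^sup>2)"
proof -
  let ?E = "\<lambda>n. truncated_entries n n c"
  have "norm (s\<^sup>2) < 1" using s by (simp add: norm_power_less_1)
  hence "(\<lambda>n. gaussian s m * qbinomial (s\<^sup>2) (int n + m) (int n - m)) \<longlonglongrightarrow>
      gaussian s m * (1 / qpoch_inf (s\<^sup>2) (s\<^sup>2))"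
    by (intro tendsto_mult_left qbinomial_tendsto)
  moreover have "(\<lambda>n. entry_gf s (?E n) m) \<longlonglongrightarrow> frobenius_gf s {c} m"
  proof -
    have "(\<Union>n. ?E n) = entries {c}" by (auto simp: truncated_entries_def entries_def)
    moreover have "finite (?E n)" for n by (simp add: truncated_entries_def)
    moreover have "incseq ?E" by (auto simp: truncated_entries_def incseq_def)
    ultimately show ?thesis
      using charge_gf_tendsto[of "entry_weight s" ?E] summable_on_entry_weight[OF s, of "{c}"]
      by (simp add: frobenius_gf_def)
  qed
  ultimately show ?thesis
    unfolding entry_gf_truncated_entries[OF power_neq_1_if_norm_less_1[OF s]]
    by (auto dest: LIMSEQ_unique)
qed

section \<open>Frobenius symbols as charged sets of entries\<close>

interpretation colored: linorder "\<lambda>x y. x = y \<or> colored_less x y" colored_less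
  by unfold_locales (auto simp: colored_less_def prod_eq_iff)

lemma frobenius_row_iff:
  "frobenius_row k xs \<longleftrightarrow> set xs \<subseteq> UNIV \<times> {1..k} \<and> sorted_wrt colored_less (rev xs)"
  by (auto simp: frobenius_row_def sorted_wrt_rev)

lemma distinct_frobenius_row: "frobenius_row k xs \<Longrightarrow> distinct xs"
  by (simp add: frobenius_row_iff colored.strict_sorted_iff)

lemma bij_betw_set_frobenius_row:
  "bij_betw set {xs. frobenius_row k xs} (Fpow (UNIV \<times> {1..k}))"
proof (rule bij_betw_imageI)
  show "inj_on set {xs. frobenius_row k xs}"
    by (auto simp: inj_on_def frobenius_row_iff dest: colored.strict_sorted_equal)
  have "X \<in> set ` {xs. frobenius_row k xs}" if "X \<in> Fpow (UNIV \<times> {1..k})" for X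
    using that
    by (intro image_eqI[of _ _ "rev (colored.sorted_list_of_set X)"])
       (auto simp: Fpow_def frobenius_row_iff)
  thus "set ` {xs. frobenius_row k xs} = Fpow (UNIV \<times> {1..k})"
    by (auto simp: Fpow_def frobenius_row_iff)
qed

lemma sum_entry_charge_Plus:
  "finite X \<Longrightarrow> finite Y \<Longrightarrow> sum entry_charge (X <+> Y) = int (card X) - int (card Y)"
  by (simp add: sum.Plus o_def entry_charge_def)

lemma charged_subsets_entries:
  "charged_subsets entry_charge (entries C) 0 =
    {X <+> Y | X Y. X \<in> Fpow (UNIV \<times> C) \<and> Y \<in> Fpow (UNIV \<times> C) \<and> card X = card Y}" (is "?L = ?R")
proof (intro equalityI subsetI)
  fix Z assume Z: "Z \<in> ?L"
  let ?X = "Inl -` Z" and ?Y = "Inr -` Z"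
  have "Z = ?X <+> ?Y"
  proof (intro equalityI subsetI)
    fix z assume "z \<in> Z"
    thus "z \<in> ?X <+> ?Y" by (cases z) auto
  qed auto
  moreover have mem: "?X \<in> Fpow (UNIV \<times> C)" "?Y \<in> Fpow (UNIV \<times> C)"
    using Z by (auto simp: charged_subsets_def Fpow_def entries_def finite_vimageI)
  moreover have "card ?X = card ?Y"
    using Z mem sum_entry_charge_Plus[of ?X ?Y] \<open>Z = ?X <+> ?Y\<close>
    by (simp add: charged_subsets_def Fpow_def)
  ultimately show "Z \<in> ?R" by blast
qed (auto simp: charged_subsets_def Fpow_def entries_def sum_entry_charge_Plus)

lemma bij_betw_frobenius_symbols:
  "bij_betw (\<lambda>(xs, ys). set xs <+> set ys) (frobenius_symbols k)
    (charged_subsets entry_charge (entries {1..k}) 0)"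
proof (rule bij_betw_imageI)
  note row = bij_betw_set_frobenius_row[of k]
  have Plus_inject: "X = X' \<and> Y = Y'" if "X <+> Y = X' <+> Y'" for X X' Y Y' :: "(nat \<times> nat) set"
    using that by (auto simp: Plus_def)
  show "inj_on (\<lambda>(xs, ys). set xs <+> set ys) (frobenius_symbols k)"
    using bij_betw_imp_inj_on[OF row] unfolding inj_on_def frobenius_symbols_def
    by (auto dest!: Plus_inject)
  have "(set xs <+> set ys) \<in> charged_subsets entry_charge (entries {1..k}) 0"
    if "(xs, ys) \<in> frobenius_symbols k" for xs ys
  proof -
    have rows: "frobenius_row k xs" "frobenius_row k ys" and len: "length xs = length ys"
      using that by (simp_all add: frobenius_symbols_def)
    have "set xs \<in> Fpow (UNIV \<times> {1..k})" "set ys \<in> Fpow (UNIV \<times> {1..k})"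
      using rows by (simp_all add: frobenius_row_iff Fpow_def)
    moreover have "card (set xs) = card (set ys)"
      using rows[THEN distinct_frobenius_row] len by (simp add: distinct_card)
    ultimately show ?thesis unfolding charged_subsets_entries by blast
  qed
  moreover have "Z \<in> (\<lambda>(xs, ys). set xs <+> set ys) ` frobenius_symbols k"
    if Z_charged: "Z \<in> charged_subsets entry_charge (entries {1..k}) 0" for Z
  proof -
    obtain X Y where Z: "Z = X <+> Y" and XY: "X \<in> Fpow (UNIV \<times> {1..k})" "Y \<in> Fpow (UNIV \<times> {1..k})"
      and card: "card X = card Y"
      using Z_charged unfolding charged_subsets_entries by blast
    obtain xs ys where rows: "frobenius_row k xs" "X = set xs" "frobenius_row k ys" "Y = set ys"
      using XY unfolding bij_betw_imp_surj_on[OF row, symmetric] by blast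
    have "length xs = length ys"
      using card rows(2,4) rows(1,3)[THEN distinct_frobenius_row] by (simp add: distinct_card)
    hence "(xs, ys) \<in> frobenius_symbols k" using rows(1,3) by (simp add: frobenius_symbols_def)
    thus ?thesis by (rule rev_image_eqI) (simp add: Z rows)
  qed
  ultimately show "(\<lambda>(xs, ys). set xs <+> set ys) ` frobenius_symbols k =
      charged_subsets entry_charge (entries {1..k}) 0"
    by (intro equalityI subsetI) auto
qed

lemma prod_entry_weight_frobenius_symbol:
  assumes "(xs, ys) \<in> frobenius_symbols k"
  shows "prod (entry_weight s) (set xs <+> set ys) = (s\<^sup>2) ^ frobenius_size (xs, ys)"
proof -
  have row: "(\<Prod>(l, c)\<in>set zs. s ^ (2 * l + 1)) = s ^ (2 * sum_list (map fst zs) + length zs)"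
    if "distinct zs" for zs :: "(nat \<times> nat) list"
    using that by (induction zs) (auto simp: power_add)
  have "distinct xs" "distinct ys" "length ys = length xs"
    using assms distinct_frobenius_row by (auto simp: frobenius_symbols_def)
  hence "prod (entry_weight s) (set xs <+> set ys) =
      s ^ (2 * sum_list (map fst xs) + length xs) * s ^ (2 * sum_list (map fst ys) + length xs)"
    by (simp add: prod.Plus o_def entry_weight_def row[simplified])
  also have "\<dots> = s ^ (2 * frobenius_size (xs, ys))"
    by (simp add: frobenius_size_def algebra_simps flip: power_add)
  finally show ?thesis by (simp only: power_mult)
qed

lemma cphi_sums_frobenius_gf:
  assumes s: "norm s < 1"
  shows "(\<lambda>n. of_nat (cphi k n) * (s\<^sup>2) ^ n) sums frobenius_gf s {1..k} 0"
proof -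
  let ?S = "SIGMA n:UNIV. frobenius_partitions k n"
  have "(prod (entry_weight s) has_sum frobenius_gf s {1..k} 0)
      (charged_subsets entry_charge (entries {1..k}) 0)"
    unfolding frobenius_gf_def by (intro has_sum_charge_gf summable_on_entry_weight s) simp
  also have "?this \<longleftrightarrow> ((\<lambda>(xs, ys). prod (entry_weight s) (set xs <+> set ys)) has_sum
      frobenius_gf s {1..k} 0) (frobenius_symbols k)"
    by (subst has_sum_reindex_bij_betw[OF bij_betw_frobenius_symbols, symmetric])
       (simp add: case_prod_unfold)
  also have "\<dots> \<longleftrightarrow> ((\<lambda>(n, z). (s\<^sup>2) ^ n) has_sum frobenius_gf s {1..k} 0) ?S"
    by (rule has_sum_reindex_bij_witness[of _ snd "\<lambda>z. (frobenius_size z, z)"])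
       (auto simp: frobenius_partitions_def prod_entry_weight_frobenius_symbol)
  finally have "((\<lambda>n. of_nat (cphi k n) * (s\<^sup>2) ^ n) has_sum frobenius_gf s {1..k} 0) UNIV"
  proof (rule has_sum_SigmaD)
    fix n
    show "((\<lambda>z. case (n, z) of (n, z) \<Rightarrow> (s\<^sup>2) ^ n) has_sum of_nat (cphi k n) * (s\<^sup>2) ^ n)
        (frobenius_partitions k n)"
      by (intro has_sum_finiteI finite_frobenius_partitions) (simp add: cphi_def)
  qed
  thus ?thesis by (rule has_sum_imp_sums)
qed

section \<open>Convolution powers of a Gaussian\<close>

text \<open>\<open>gaussian_power s k m\<close> is the sum of \<open>s\<^bsup>m\<^sub>1\<^sup>2 + \<dots> + m\<^sub>k\<^sup>2\<^esup>\<close> over all integers with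
  \<open>m\<^sub>1 + \<dots> + m\<^sub>k = m\<close>.\<close>

primrec gaussian_power :: "complex \<Rightarrow> nat \<Rightarrow> int \<Rightarrow> complex" where
  "gaussian_power s 0 m = (if m = 0 then 1 else 0)"
| "gaussian_power s (Suc k) m = (\<Sum>\<^sub>\<infinity>j. gaussian s j * gaussian_power s k (m - j))"

lemma frobenius_gf_eq_gaussian_power:
  assumes s: "norm s < 1" and "finite C"
  shows "frobenius_gf s C m = gaussian_power s (card C) m / qpoch_inf (s\<^sup>2) (s\<^sup>2) ^ card C"
  using \<open>finite C\<close>
proof (induction C arbitrary: m rule: finite_induct)
  case empty
  show ?case by (simp add: frobenius_gf_empty)
next
  case (insert c C)
  let ?Q = "qpoch_inf (s\<^sup>2) (s\<^sup>2)"
  have "frobenius_gf s (insert c C) m = (\<Sum>\<^sub>\<infinity>j. frobenius_gf s {c} j * frobenius_gf s C (m - j))"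
    using frobenius_gf_Un[OF s, of "{c}" C m] insert.hyps by (simp add: infsumI)
  also have "\<dots> = (\<Sum>\<^sub>\<infinity>j. gaussian s j * gaussian_power s (card C) (m - j) / ?Q ^ Suc (card C))"
    by (simp add: frobenius_gf_singleton[OF s] insert.IH)
  also have "\<dots> = gaussian_power s (card (insert c C)) m / ?Q ^ card (insert c C)"
    using insert.hyps by (simp add: divide_inverse infsum_cmult_left')
  finally show ?case .
qed

theorem cphi_sums_gaussian_power:
  assumes s: "norm s < 1"
  shows "(\<lambda>n. of_nat (cphi k n) * (s\<^sup>2) ^ n) sums
    (gaussian_power s k 0 / qpoch_inf (s\<^sup>2) (s\<^sup>2) ^ k)"
  using cphi_sums_frobenius_gf[OF s, of k] frobenius_gf_eq_gaussian_power[OF s, of "{1..k}"] by simp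

text \<open>Associativity of the convolution is inherited from splitting the colours.\<close>

lemma gaussian_power_add:
  assumes s: "norm s < 1"
  shows "((\<lambda>j. gaussian_power s k j * gaussian_power s l (m - j)) has_sum
    gaussian_power s (k + l) m) UNIV"
proof -
  let ?Q = "qpoch_inf (s\<^sup>2) (s\<^sup>2)"
  have Q: "?Q \<noteq> 0" using s by (simp add: qpoch_tendsto norm_power_less_1)
  let ?C = "{..<k}" and ?D = "{k..<k + l}"
  have gf: "frobenius_gf s C j * ?Q ^ card C = gaussian_power s (card C) j" if "finite C"
    for C :: "nat set" and j
    using frobenius_gf_eq_gaussian_power[OF s that] Q by simp
  have CD: "?C \<union> ?D = {..<k + l}" "?C \<inter> ?D = {}" by auto
  have "((\<lambda>j. frobenius_gf s ?C j * frobenius_gf s ?D (m - j) * ?Q ^ (k + l)) has_sum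
      frobenius_gf s {..<k + l} m * ?Q ^ (k + l)) UNIV"
    using frobenius_gf_Un[OF s, of ?C ?D m] CD by (intro has_sum_cmult_left) simp
  moreover have "frobenius_gf s ?C j * frobenius_gf s ?D (m - j) * ?Q ^ (k + l) =
      gaussian_power s k j * gaussian_power s l (m - j)" for j
    using gf[of ?C j] gf[of ?D "m - j"] by (simp add: power_add flip: gf) (simp add: ac_simps)
  ultimately show ?thesis using gf[of "{..<k + l}" m] by simp
qed

lemma gaussian_power_minus: "gaussian_power s k (- m) = gaussian_power s k m"
proof (induction k arbitrary: m)
  case (Suc k)
  have "gaussian_power s k (- m - j) = gaussian_power s k (m + j)" for j
    using Suc[of "m + j"] by simp
  thus ?case
    unfolding gaussian_power.simps
    by (intro infsum_reindex_bij_witness[of _ uminus uminus]) auto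
qed simp

lemma gaussian_power_1: "gaussian_power s (Suc 0) = gaussian s"
proof
  fix m
  have "((\<lambda>j. gaussian s j * gaussian_power s 0 (m - j)) has_sum gaussian s m) UNIV"
    by (rule has_sum_finite_neutralI[of "{m}"]) auto
  thus "gaussian_power s (Suc 0) m = gaussian s m" by (simp add: infsumI)
qed

section \<open>Theta series by parity class\<close>

lemma summable_on_gaussian:
  fixes r :: "'a::{real_normed_div_algebra, banach}"
  assumes r: "norm r < 1"
  shows "gaussian r summable_on A"
proof -
  let ?g = "\<lambda>n. norm (gaussian r n)"
  have "norm (gaussian r (int n)) \<le> norm r ^ n" for n
    using r self_le_power[of n 2]
    by (cases "n = 0") (auto simp: gaussian_def norm_power nat_power_eq intro!: power_decreasing)
  moreover have "(\<lambda>n. norm r ^ n) summable_on UNIV"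
    using r by (intro summable_nonneg_imp_summable_on) (auto intro: summable_geometric)
  ultimately have "(\<lambda>n. ?g (int n)) summable_on UNIV"
    by (intro Infinite_Sum.abs_summable_on_comparison_test'[where g = "\<lambda>n. norm r ^ n"]) auto
  hence "?g summable_on range int" "?g summable_on range (\<lambda>n. - int n)"
    by (subst summable_on_reindex; simp add: inj_on_def o_def)+
  hence "?g summable_on (range int \<union> range (\<lambda>n. - int n))"
    by (rule summable_on_union)
  moreover have "n \<in> range int \<union> range (\<lambda>n. - int n)" for n
    by (cases n rule: int_cases2) auto
  ultimately have "?g summable_on UNIV" by (metis UNIV_eq_I)
  thus ?thesis by (rule summable_on_subset_banach[OF abs_summable_summable]) simp
qed

definition parity_theta :: "complex \<Rightarrow> int \<Rightarrow> complex" where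
  "parity_theta r a = (\<Sum>\<^sub>\<infinity>n | even n \<longleftrightarrow> even a. gaussian r n)"

lemma has_sum_parity_theta:
  assumes "norm r < 1"
  shows "(gaussian r has_sum parity_theta r a) {n. even n \<longleftrightarrow> even a}"
  unfolding parity_theta_def by (intro has_sum_infsum summable_on_gaussian assms)

lemma parity_theta_even: "even a \<Longrightarrow> parity_theta r a = parity_theta r 0"
  and parity_theta_odd: "odd a \<Longrightarrow> parity_theta r a = parity_theta r 1"
  by (simp_all add: parity_theta_def)

lemma has_sum_even_odd:
  fixes f :: "int \<Rightarrow> 'a::topological_comm_monoid_add"
  assumes "(f has_sum a) {n. even n}" "(f has_sum b) {n. odd n}"
  shows "(f has_sum (a + b)) UNIV"
proof -
  have "{n::int. even n} \<union> {n. odd n} = UNIV" "{n::int. even n} \<inter> {n. odd n} = {}" by auto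
  thus ?thesis using has_sum_Un_disjoint[OF assms] by simp
qed

lemma has_sum_gaussian_parity:
  assumes r: "norm r < 1" and \<phi>: "\<And>m n. even m = even n \<Longrightarrow> \<phi> m = \<phi> n"
  shows "((\<lambda>n. gaussian r n * \<phi> n) has_sum parity_theta r 0 * \<phi> 0 + parity_theta r 1 * \<phi> 1) UNIV"
proof (rule has_sum_even_odd)
  have "((\<lambda>n. gaussian r n * \<phi> n) has_sum parity_theta r a * \<phi> a) {n. even n \<longleftrightarrow> even a}" for a
  proof -
    have "((\<lambda>n. gaussian r n * \<phi> a) has_sum parity_theta r a * \<phi> a) {n. even n \<longleftrightarrow> even a}"
      by (intro has_sum_cmult_left has_sum_parity_theta r)
    also have "?this \<longleftrightarrow> ?thesis"
      by (intro has_sum_cong arg_cong2[where f = "(*)"] refl \<phi>) simp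
    finally show ?thesis .
  qed
  from this[of 0] this[of 1]
  show "((\<lambda>n. gaussian r n * \<phi> n) has_sum parity_theta r 0 * \<phi> 0) {n. even n}"
    "((\<lambda>n. gaussian r n * \<phi> n) has_sum parity_theta r 1 * \<phi> 1) {n. odd n}" by simp_all
qed

lemma has_sum_gaussian_convolution:
  assumes r: "norm r < 1"
  shows "((\<lambda>b. gaussian (r\<^sup>2) b * gaussian (r\<^sup>2) (a - b)) has_sum
    gaussian r a * parity_theta r a) UNIV"
proof -
  have "((\<lambda>n. gaussian r a * gaussian r n) has_sum gaussian r a * parity_theta r a)
      {n. even n \<longleftrightarrow> even a}"
    by (intro has_sum_cmult_right has_sum_parity_theta r)
  also have "?this \<longleftrightarrow> ?thesis"
  proof (rule has_sum_reindex_bij_witness[of _ "\<lambda>b. 2 * b - a" "\<lambda>n. (n + a) div 2"], goal_cases)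
    case (5 n)
    define b where "b = (n + a) div 2"
    have "n = b - (a - b)" using 5 unfolding b_def by auto
    thus ?case
      using gaussian_parallelogram[of r b "a - b"] by (simp flip: b_def)
  qed auto
  finally show ?thesis .
qed

lemma has_sum_gaussian_convolution_parity:
  assumes r: "norm r < 1" and \<phi>: "\<And>m n. even m = even n \<Longrightarrow> \<phi> m = \<phi> n"
  shows "((\<lambda>b. gaussian r b * gaussian r (2 * k - b) * \<phi> b) has_sum
    gaussian (r\<^sup>2) k * (parity_theta (r\<^sup>2) 0 * \<phi> k + parity_theta (r\<^sup>2) 1 * \<phi> (k + 1))) UNIV"
proof -
  have "norm (r\<^sup>2) < 1" using r by (simp add: norm_power_less_1)
  hence "((\<lambda>n. gaussian (r\<^sup>2) n * \<phi> (k + n)) has_sum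
      parity_theta (r\<^sup>2) 0 * \<phi> (k + 0) + parity_theta (r\<^sup>2) 1 * \<phi> (k + 1)) UNIV"
    by (rule has_sum_gaussian_parity) (intro \<phi>, simp)
  hence "((\<lambda>n. gaussian (r\<^sup>2) k * (gaussian (r\<^sup>2) n * \<phi> (k + n))) has_sum
      gaussian (r\<^sup>2) k * (parity_theta (r\<^sup>2) 0 * \<phi> k + parity_theta (r\<^sup>2) 1 * \<phi> (k + 1))) UNIV"
    unfolding add_0_right by (rule has_sum_cmult_right)
  also have "?this \<longleftrightarrow> ?thesis"
  proof (rule has_sum_reindex_bij_witness[of _ "\<lambda>b. b - k" "\<lambda>n. k + n"], goal_cases)
    case (5 n)
    show ?case using gaussian_parallelogram[of r k n] by (simp flip: mult.assoc)
  qed auto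
  finally show ?thesis .
qed

lemma parity_theta_square:
  assumes r: "norm r < 1"
  shows "(parity_theta r a)\<^sup>2 = parity_theta (r\<^sup>2) 0 * parity_theta (r\<^sup>2) a
    + parity_theta (r\<^sup>2) 1 * parity_theta (r\<^sup>2) (a + 1)"
proof -
  let ?P = "{n::int. even n \<longleftrightarrow> even a}" and ?\<theta> = "parity_theta (r\<^sup>2)"
  define \<phi> :: "int \<Rightarrow> complex" where "\<phi> n = (if even n \<longleftrightarrow> even a then 1 else 0)" for n
  define \<psi> where "\<psi> u = ?\<theta> 0 * \<phi> u + ?\<theta> 1 * \<phi> (u + 1)" for u
  have "((\<lambda>(m, n). gaussian r m * gaussian r n) has_sum (parity_theta r a)\<^sup>2) (?P \<times> ?P)"
    unfolding power2_eq_square by (intro has_sum_Times has_sum_parity_theta r)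
  also have "?this \<longleftrightarrow> ((\<lambda>(u, m). gaussian r m * gaussian r (2 * u - m)) has_sum
      (parity_theta r a)\<^sup>2) (UNIV \<times> ?P)"
    by (rule has_sum_reindex_bij_witness
        [of _ "\<lambda>(u, m). (m, 2 * u - m)" "\<lambda>(m, n). ((m + n) div 2, m)"]) auto
  finally have "((\<lambda>u. gaussian (r\<^sup>2) u * \<psi> u) has_sum (parity_theta r a)\<^sup>2) UNIV"
  proof (rule has_sum_SigmaD)
    fix u
    have "((\<lambda>m. gaussian r m * gaussian r (2 * u - m) * \<phi> m) has_sum gaussian (r\<^sup>2) u * \<psi> u) UNIV"
      unfolding \<psi>_def by (rule has_sum_gaussian_convolution_parity[OF r]) (simp add: \<phi>_def)
    also have "?this \<longleftrightarrow> ((\<lambda>m. case (u, m) of (u, m) \<Rightarrow> gaussian r m * gaussian r (2 * u - m)) has_sum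
        gaussian (r\<^sup>2) u * \<psi> u) ?P"
      by (rule has_sum_cong_neutral) (auto simp: \<phi>_def)
    finally show "((\<lambda>m. case (u, m) of (u, m) \<Rightarrow> gaussian r m * gaussian r (2 * u - m)) has_sum
        gaussian (r\<^sup>2) u * \<psi> u) ?P" .
  qed
  moreover have "((\<lambda>u. gaussian (r\<^sup>2) u * \<psi> u) has_sum ?\<theta> 0 * \<psi> 0 + ?\<theta> 1 * \<psi> 1) UNIV"
    by (rule has_sum_gaussian_parity)
      (use r in \<open>simp_all add: \<psi>_def \<phi>_def norm_power_less_1\<close>)
  ultimately have "(parity_theta r a)\<^sup>2 = ?\<theta> 0 * \<psi> 0 + ?\<theta> 1 * \<psi> 1"
    by (rule has_sum_unique)
  thus ?thesis
    using parity_theta_even[of a "r\<^sup>2"] parity_theta_odd[of a "r\<^sup>2"]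
      parity_theta_even[of "a + 1" "r\<^sup>2"] parity_theta_odd[of "a + 1" "r\<^sup>2"]
    by (cases "even a") (simp_all add: \<psi>_def \<phi>_def)
qed

lemma parity_theta_0_square:
  "norm r < 1 \<Longrightarrow> (parity_theta r 0)\<^sup>2 = (parity_theta (r\<^sup>2) 0)\<^sup>2 + (parity_theta (r\<^sup>2) 1)\<^sup>2"
  and parity_theta_1_square:
  "norm r < 1 \<Longrightarrow> (parity_theta r 1)\<^sup>2 = 2 * parity_theta (r\<^sup>2) 0 * parity_theta (r\<^sup>2) 1"
  using parity_theta_square[of r 0] parity_theta_square[of r 1] parity_theta_even[of 2 "r\<^sup>2"]
  by (simp_all add: power2_eq_square)

lemma Theta3_power4_eq_parity_theta: "Theta3 (r ^ 4) = parity_theta r 0"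
proof -
  have "infsum (gaussian (r ^ 4)) UNIV = infsum (gaussian r) {n. even n}"
    by (rule infsum_reindex_bij_witness[of _ "\<lambda>n. n div 2" "\<lambda>n. 2 * n"])
      (auto simp: gaussian_double)
  thus ?thesis by (simp add: Theta3_def parity_theta_def gaussian_def[abs_def])
qed

lemma Theta3_eq_parity_theta:
  assumes "norm r < 1"
  shows "Theta3 r = parity_theta r 0 + parity_theta r 1"
  using has_sum_gaussian_parity[OF assms, of "\<lambda>_. 1"]
  by (simp add: infsumI Theta3_def gaussian_def[abs_def])

lemma Theta2_root_eq_parity_theta: "Theta2_root r = parity_theta r 1"
proof -
  have "infsum (\<lambda>n. gaussian r (2 * n + 1)) UNIV = infsum (gaussian r) {n. odd n}"
    by (rule infsum_reindex_bij_witness[of _ "\<lambda>n. n div 2" "\<lambda>n. 2 * n + 1"]) auto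
  thus ?thesis by (simp add: Theta2_root_def parity_theta_def gaussian_def[abs_def])
qed

section \<open>Eight colours\<close>

lemma gaussian_power_2:
  assumes r: "norm r < 1"
  shows "gaussian_power (r\<^sup>2) 2 a = gaussian r a * parity_theta r a"
proof -
  have "norm (r\<^sup>2) < 1" using r by (simp add: norm_power_less_1)
  from gaussian_power_add[OF this, of 1 1 a] show ?thesis
    using has_sum_gaussian_convolution[OF r, of a]
    by (auto simp: gaussian_power_1 numeral_2_eq_2 dest: has_sum_unique)
qed

lemma has_sum_gaussian_power_4:
  assumes r: "norm r < 1"
  shows "((\<lambda>b. gaussian r b * gaussian r (a - b) * (parity_theta r b * parity_theta r (a - b)))
    has_sum gaussian_power (r\<^sup>2) 4 a) UNIV"
proof -
  have "norm (r\<^sup>2) < 1" using r by (simp add: norm_power_less_1)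
  from gaussian_power_add[OF this, of 2 2 a] show ?thesis
    by (simp add: gaussian_power_2[OF r] ac_simps)
qed

lemma gaussian_power_4_even:
  assumes r: "norm r < 1"
  shows "gaussian_power (r\<^sup>2) 4 (2 * k) = gaussian (r\<^sup>2) k *
    (parity_theta (r\<^sup>2) 0 * (parity_theta r k)\<^sup>2 +
      parity_theta (r\<^sup>2) 1 * (parity_theta r (k + 1))\<^sup>2)"
proof -
  have "parity_theta r b * parity_theta r (2 * k - b) = (parity_theta r b)\<^sup>2" for b
    by (simp add: parity_theta_def power2_eq_square)
  hence "((\<lambda>b. gaussian r b * gaussian r (2 * k - b) * (parity_theta r b)\<^sup>2) has_sum
      gaussian_power (r\<^sup>2) 4 (2 * k)) UNIV"
    using has_sum_gaussian_power_4[OF r, of "2 * k"] by simp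
  moreover have "((\<lambda>b. gaussian r b * gaussian r (2 * k - b) * (parity_theta r b)\<^sup>2) has_sum
      gaussian (r\<^sup>2) k * (parity_theta (r\<^sup>2) 0 * (parity_theta r k)\<^sup>2 +
        parity_theta (r\<^sup>2) 1 * (parity_theta r (k + 1))\<^sup>2)) UNIV"
    by (rule has_sum_gaussian_convolution_parity[OF r]) (simp add: parity_theta_def)
  ultimately show ?thesis by (rule has_sum_unique)
qed

text \<open>For odd \<open>a\<close>, \<open>gaussian_power (r\<^sup>2) 4 a\<close> itself is a Gaussian in a square root of \<open>r\<close>;
  squaring removes that root.\<close>

lemma gaussian_power_4_odd_square:
  assumes r: "norm r < 1" and a: "odd a"
  shows "(gaussian_power (r\<^sup>2) 4 a)\<^sup>2 =
    gaussian r a * (2 * (parity_theta r 0 * parity_theta r 1) ^ 3)"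
proof -
  define t where "t = csqrt r"
  have t: "norm t < 1" "t\<^sup>2 = r" using r by (simp_all add: t_def norm_csqrt)
  let ?\<theta> = "parity_theta r 0 * parity_theta r 1"
  have "parity_theta r b * parity_theta r (a - b) = ?\<theta>" for b
    using a parity_theta_even[of b r] parity_theta_even[of "a - b" r]
      parity_theta_odd[of b r] parity_theta_odd[of "a - b" r]
    by (cases "even b") simp_all
  hence "((\<lambda>b. gaussian r b * gaussian r (a - b) * ?\<theta>) has_sum gaussian_power (r\<^sup>2) 4 a) UNIV"
    using has_sum_gaussian_power_4[OF r, of a] by simp
  moreover have "((\<lambda>b. gaussian r b * gaussian r (a - b) * ?\<theta>) has_sum
      gaussian t a * parity_theta t 1 * ?\<theta>) UNIV"
    using has_sum_gaussian_convolution[OF t(1), of a] parity_theta_odd[OF a, of t] t(2)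
    by (intro has_sum_cmult_left) simp
  ultimately have "gaussian_power (r\<^sup>2) 4 a = gaussian t a * parity_theta t 1 * ?\<theta>"
    by (rule has_sum_unique)
  hence "(gaussian_power (r\<^sup>2) 4 a)\<^sup>2 =
      (gaussian t a)\<^sup>2 * (parity_theta t 1)\<^sup>2 * ?\<theta>\<^sup>2"
    by (simp only: power_mult_distrib)
  also have "(gaussian t a)\<^sup>2 = gaussian r a"
    using gaussian_square[of t a] by (simp add: t(2))
  also have "(parity_theta t 1)\<^sup>2 = 2 * ?\<theta>"
    using parity_theta_1_square[OF t(1)] by (simp add: t(2))
  finally show ?thesis by (simp add: power2_eq_square power3_eq_cube)
qed

lemma gaussian_power_8:
  assumes r: "norm r < 1"
  defines "x \<equiv> parity_theta (r ^ 4) 0" and "y \<equiv> parity_theta (r ^ 4) 1"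
    and "X \<equiv> parity_theta (r\<^sup>2) 0" and "Y \<equiv> parity_theta (r\<^sup>2) 1"
    and "A \<equiv> parity_theta r 0" and "B \<equiv> parity_theta r 1"
  shows "gaussian_power (r\<^sup>2) 8 0 =
    x * (X * A\<^sup>2 + Y * B\<^sup>2)\<^sup>2 + y * (X * B\<^sup>2 + Y * A\<^sup>2)\<^sup>2 + B * (2 * (A * B) ^ 3)"
proof -
  define \<phi> where "\<phi> k = (X * (parity_theta r k)\<^sup>2 + Y * (parity_theta r (k + 1))\<^sup>2)\<^sup>2" for k
  have r2: "norm (r\<^sup>2) < 1" and r4: "norm (r ^ 4) < 1"
    using r by (simp_all add: norm_power_less_1)
  have "(gaussian (r\<^sup>2) k)\<^sup>2 = gaussian (r ^ 4) k" for k
    by (simp add: gaussian_square flip: power_mult)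
  hence even_square: "(gaussian_power (r\<^sup>2) 4 (2 * k))\<^sup>2 = gaussian (r ^ 4) k * \<phi> k" for k
    by (simp only: gaussian_power_4_even[OF r] \<phi>_def X_def Y_def power_mult_distrib)
  have "((\<lambda>k. gaussian (r ^ 4) k * \<phi> k) has_sum x * \<phi> 0 + y * \<phi> 1) UNIV"
    unfolding x_def y_def
    by (rule has_sum_gaussian_parity[OF r4]) (simp add: \<phi>_def parity_theta_def)
  also have "?this \<longleftrightarrow> ((\<lambda>a. (gaussian_power (r\<^sup>2) 4 a)\<^sup>2) has_sum x * \<phi> 0 + y * \<phi> 1) {a. even a}"
    by (rule has_sum_reindex_bij_witness[of _ "\<lambda>a. a div 2" "\<lambda>k. 2 * k"])
      (auto simp: even_square)
  finally have even: "((\<lambda>a. (gaussian_power (r\<^sup>2) 4 a)\<^sup>2) has_sum x * \<phi> 0 + y * \<phi> 1) {a. even a}" .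
  have "((\<lambda>a. gaussian r a * (2 * (A * B) ^ 3)) has_sum B * (2 * (A * B) ^ 3)) {a. odd a}"
    using has_sum_parity_theta[OF r, of 1] unfolding B_def by (intro has_sum_cmult_left) simp
  hence odd: "((\<lambda>a. (gaussian_power (r\<^sup>2) 4 a)\<^sup>2) has_sum B * (2 * (A * B) ^ 3)) {a. odd a}"
    by (rule has_sum_cong[THEN iffD1, rotated])
      (simp add: gaussian_power_4_odd_square[OF r] A_def B_def)
  have "((\<lambda>a. (gaussian_power (r\<^sup>2) 4 a)\<^sup>2) has_sum gaussian_power (r\<^sup>2) 8 0) UNIV"
    using gaussian_power_add[OF r2, of 4 4 0] by (simp add: gaussian_power_minus power2_eq_square)
  from has_sum_unique[OF this has_sum_even_odd[OF even odd]] show ?thesis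
    using parity_theta_even[of 2 r] by (simp add: \<phi>_def A_def B_def)
qed

lemma theta_polynomial_identity:
  fixes x y X Y A B :: "'a::idom"
  assumes A: "A = x + y" and B: "B\<^sup>2 = 2 * X * Y"
    and X: "X\<^sup>2 = x\<^sup>2 + y\<^sup>2" and Y: "Y\<^sup>2 = 2 * x * y"
  shows "x * (X * A\<^sup>2 + Y * B\<^sup>2)\<^sup>2 + y * (X * B\<^sup>2 + Y * A\<^sup>2)\<^sup>2 + B * (2 * (A * B) ^ 3) =
    x ^ 7 + 28 * x ^ 6 * y + 105 * x ^ 5 * y\<^sup>2 + 112 * x ^ 4 * y ^ 3 + 147 * x ^ 3 * y ^ 4
      + 84 * x\<^sup>2 * y ^ 5 + 35 * x * y ^ 6"
proof -
  have "(X * A\<^sup>2 + Y * B\<^sup>2)\<^sup>2 = X\<^sup>2 * (A\<^sup>2 + 2 * Y\<^sup>2)\<^sup>2"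
    unfolding B by algebra
  moreover have "(X * B\<^sup>2 + Y * A\<^sup>2)\<^sup>2 = Y\<^sup>2 * (A\<^sup>2 + 2 * X\<^sup>2)\<^sup>2"
    unfolding B by algebra
  moreover have "B * (2 * (A * B) ^ 3) = 8 * A ^ 3 * (X\<^sup>2 * Y\<^sup>2)"
  proof -
    have "B * (2 * (A * B) ^ 3) = 2 * A ^ 3 * (B\<^sup>2)\<^sup>2" by algebra
    thus ?thesis unfolding B by algebra
  qed
  ultimately show ?thesis
    unfolding X Y A by (simp add: eval_nat_numeral algebra_simps)
qed

lemma gaussian_power_8_eq_Theta:
  assumes q: "norm q < 1" and s: "s\<^sup>2 = q"
  shows "gaussian_power s 8 0 =
    Theta3 (q ^ 4) ^ 7
       + 28 * Theta3 (q ^ 4) ^ 6 * Theta2_root q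
       + 105 * Theta3 (q ^ 4) ^ 5 * Theta2_root q ^ 2
       + 112 * Theta3 (q ^ 4) ^ 4 * Theta2_root q ^ 3
       + 147 * Theta3 (q ^ 4) ^ 3 * Theta2_root q ^ 4
       + 84 * Theta3 (q ^ 4) ^ 2 * Theta2_root q ^ 5
       + 35 * Theta3 (q ^ 4) * Theta2_root q ^ 6"
proof -
  define r where "r = csqrt s"
  have "r\<^sup>2 = s" by (simp add: r_def)
  have "r ^ 4 = q" by (simp add: s \<open>r\<^sup>2 = s\<close> flip: power_mult[of r 2 2, simplified])
  have r: "norm r < 1"
    using q by (simp add: norm_power power_less_one_iff flip: \<open>r ^ 4 = q\<close>)
  hence r2: "norm (r\<^sup>2) < 1" by (simp add: norm_power_less_1)
  have r4: "(r\<^sup>2)\<^sup>2 = r ^ 4" by (simp flip: power_mult)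
  have "parity_theta r 0 = parity_theta (r ^ 4) 0 + parity_theta (r ^ 4) 1"
    using q Theta3_eq_parity_theta[of "r ^ 4"] Theta3_power4_eq_parity_theta[of r]
    by (simp add: \<open>r ^ 4 = q\<close>)
  from theta_polynomial_identity[OF this parity_theta_1_square[OF r]
      parity_theta_0_square[OF r2, unfolded r4] parity_theta_1_square[OF r2, unfolded r4]]
  show ?thesis
    using gaussian_power_8[OF r]
    by (simp add: Theta3_power4_eq_parity_theta Theta2_root_eq_parity_theta \<open>r ^ 4 = q\<close> \<open>r\<^sup>2 = s\<close>)
qed

theorem theorem6p3:
  fixes q :: complex
  assumes "norm q < 1"
  shows "summable (\<lambda>n. of_nat (cphi 8 n) * q ^ n) \<and>
    CPhi 8 q = 1 / (qpoch_inf q q) ^ 8 *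
      (Theta3 (q ^ 4) ^ 7
       + 28 * Theta3 (q ^ 4) ^ 6 * Theta2_root q
       + 105 * Theta3 (q ^ 4) ^ 5 * Theta2_root q ^ 2
       + 112 * Theta3 (q ^ 4) ^ 4 * Theta2_root q ^ 3
       + 147 * Theta3 (q ^ 4) ^ 3 * Theta2_root q ^ 4
       + 84 * Theta3 (q ^ 4) ^ 2 * Theta2_root q ^ 5
       + 35 * Theta3 (q ^ 4) * Theta2_root q ^ 6)"
proof -
  define s where "s = csqrt q"
  have s: "s\<^sup>2 = q" "norm s < 1" using assms by (simp_all add: s_def norm_csqrt)
  show ?thesis
    using cphi_sums_gaussian_power[OF s(2), of 8]
    unfolding s(1) gaussian_power_8_eq_Theta[OF assms s(1)] CPhi_def by (simp add: sums_iff)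
qed

end
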